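(* Let $g\in\mathbb{C}^N$ be a generator such that one of the following two conditions is satisfied: (a) $\langle g,g_{\hat p,\ell}\rangle=0$ for a fixed $\hat p\in\mathbb{Z}_N\setminus\{0\}$ and all $\ell\in\mathbb{Z}_N$; (b) $\langle g,g_{\hat p,\ell}\rangle=0$ for $\hat p=0$ and all $\ell\in\mathbb{Z}_N\setminus\{0\}$. Then the corresponding Gabor frame $G=(g_\lambda)_{\lambda\in\mathbb{Z}_N^2}$ does not allow phase retrieval for $\mathbb{C}^N$.
   Context: Vectors in $\mathbb{C}^N$ are indexed by $\mathbb{Z}_N=\mathbb{Z}/N\mathbb{Z}$, and $\omega=e^{2\pi i/N}$. The scalar product is $\langle x,y\rangle=\sum_{j\in\mathbb{Z}_N}\overline{x(j)}\,y(j)$. Translations and modulations are $(T_px)(n)=x(n-p)$ and $(M_\ell x)(n)=\omega^{\ell n}x(n)$ for $p,\ell\in\mathbb{Z}_N$. For $\lambda=(p,\ell)\in\mathbb{Z}_N^2$ put $g_\lambda=g_{p,\ell}=M_\ell T_pg$. Let $\mathbb{T}=\{c\in\mathbb{C}:|c|=1\}$. The system $(g_\lambda)_{\lambda\in\mathbb{Z}_N^2}$ allows phase retrieval for $\mathbb{C}^N$ if the map $x\mapsto(|\langle x,g_\lambda\rangle|^2)_{\lambda\in\mathbb{Z}_N^2}$ is injective on $\mathbb{C}^N/\mathbb{T}$; i.e. whenever $x,y\in\mathbb{C}^N$ satisfy $|\langle x,g_\lambda\rangle|=|\langle y,g_\lambda\rangle|$ for all $\lambda\in\mathbb{Z}_N^2$,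 there is $c\in\mathbb{T}$ with $x=cy$.
   Formalization: The dimension N is assumed to be at least 2; for N = 1 condition (b) is vacuous and any nonzero g allows phase retrieval for C^1, so the claim fails there. *)

theory Defs
  imports "HOL-Analysis.Analysis" "Berlekamp_Zassenhaus.Finite_Field"
begin

text \<open>The group of integers modulo \<open>N\<close> is the type \<open>'n mod_ring\<close> with \<open>N = CARD('n)\<close>, and
  the space of complex vectors indexed by it is \<open>complex ^ ('n mod_ring)\<close>.\<close>

text \<open>Conjugate-linear in the first argument. The library inner product on complex vectors is the
  real part of this form, so it cannot be used here.\<close>

definition cscalar_product :: "complex ^ 'i \<Rightarrow> complex ^ 'i \<Rightarrow> complex" where
  "cscalar_product x y = (\<Sum>j\<in>UNIV. cnj (x $ j) * y $ j)"

definition root_unity :: "nat \<Rightarrow> complex" where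
  "root_unity N = exp (2 * of_real pi * \<i> / of_nat N)"

definition translation ::
    "'n::finite mod_ring \<Rightarrow> complex ^ ('n mod_ring) \<Rightarrow> complex ^ ('n mod_ring)" where
  "translation p x = (\<chi> n. x $ (n - p))"

text \<open>The exponent is the product in \<open>'n mod_ring\<close>, read off at its representative in
  \<open>{0..<N}\<close>; the power does not depend on the representative.\<close>

definition modulation ::
    "'n::finite mod_ring \<Rightarrow> complex ^ ('n mod_ring) \<Rightarrow> complex ^ ('n mod_ring)" where
  "modulation l x = (\<chi> n. root_unity CARD('n) powi to_int_mod_ring (l * n) * x $ n)"

definition gabor ::
    "complex ^ ('n mod_ring) \<Rightarrow> 'n::finite mod_ring \<times> 'n mod_ring \<Rightarrow> complex ^ ('n mod_ring)" where
  "gabor g = (\<lambda>(p, l). modulation l (translation p g))"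

definition allows_phase_retrieval :: "('k \<Rightarrow> complex ^ 'i) \<Rightarrow> bool" where
  "allows_phase_retrieval G \<longleftrightarrow>
    (\<forall>x y. (\<forall>k. cmod (cscalar_product x (G k)) = cmod (cscalar_product y (G k))) \<longrightarrow>
      (\<exists>c. cmod c = 1 \<and> x = c *s y))"

end

theory Submission
  imports Defs
begin

text \<open>Write \<open>\<chi>(a) = \<omega>^a\<close> for the standard additive character of \<open>\<int>/N\<close>. The numbers
  \<open>\<langle>g, g\<^sub>p\<^sub>,\<^sub>l\<rangle>\<close> with \<open>p\<close> fixed are the Fourier coefficients of the correlation
  \<open>n \<mapsto> cnj (g n) * g (n - p)\<close>, so by Fourier inversion each hypothesis is a pointwise statement about
  \<open>g\<close>, and each yields two sparse vectors that have the same measurements.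

  If all coefficients vanish for some \<open>p \<noteq> 0\<close>, the correlation is zero: \<open>g\<close> never is nonzero at
  two positions that differ by \<open>p\<close>. Hence every time-frequency shift of \<open>g\<close> vanishes at \<open>0\<close> or at
  \<open>p\<close>, and its scalar products with \<open>e\<^sub>0 + e\<^sub>p\<close> and \<open>e\<^sub>0 - e\<^sub>p\<close> have the same modulus.

  If \<open>p = 0\<close> and all coefficients but the zeroth vanish, the correlation \<open>\<bar>g n\<bar>\<^sup>2\<close> is constant:
  all entries of all shifts of \<open>g\<close> have the same modulus, and no two coordinate vectors \<open>e\<^sub>i\<close>, \<open>e\<^sub>j\<close> can
  be told apart.

  In both cases the two vectors are not multiples of each other.\<close>

definition additive_char :: "'n::finite mod_ring \<Rightarrow> complex" where
  "additive_char a = root_unity CARD('n) powi to_int_mod_ring a"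

lemma root_unity_powi_eq_1_iff:
  assumes "N > 0"
  shows "root_unity N powi k = 1 \<longleftrightarrow> int N dvd k"
proof -
  have "root_unity N powi k = exp (of_int k * (2 * of_real pi * \<i> / of_nat N))"
    unfolding root_unity_def by (rule exp_power_int)
  also have "\<dots> = 1 \<longleftrightarrow> (\<exists>n::int. 2 * (real_of_int k * pi) / real N = real_of_int (2 * n) * pi)"
    by (simp add: exp_eq_1 ac_simps)
  also have "\<dots> \<longleftrightarrow> (\<exists>n::int. real_of_int k = real_of_int (int N * n))"
    using assms by (simp add: field_simps)
  also have "\<dots> \<longleftrightarrow> int N dvd k"
    unfolding dvd_def of_int_eq_iff ..
  finally show ?thesis .
qed

lemma root_unity_nonzero: "root_unity N \<noteq> 0"
  by (simp add: root_unity_def)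

lemma norm_root_unity: "cmod (root_unity N) = 1"
  by (simp add: root_unity_def)

lemma norm_additive_char: "cmod (additive_char a) = 1"
  by (simp add: additive_char_def norm_power_int norm_root_unity)

lemma additive_char_0: "additive_char 0 = 1"
  by (simp add: additive_char_def)

lemma additive_char_add:
  "additive_char (a + b) = additive_char a * additive_char (b :: 'n::finite mod_ring)"
proof -
  let ?w = "root_unity CARD('n)"
  let ?s = "to_int_mod_ring a + to_int_mod_ring b"
  have "to_int_mod_ring (a + b) = ?s mod int CARD('n)"
    by transfer simp
  then have "?s = int CARD('n) * (?s div int CARD('n)) + to_int_mod_ring (a + b)"
    by simp
  then have "?w powi ?s = ?w powi (int CARD('n) * (?s div int CARD('n))) * additive_char (a + b)"
    unfolding additive_char_def by (metis power_int_add root_unity_nonzero)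
  moreover have "?w powi (int CARD('n) * (?s div int CARD('n))) = 1"
    by (subst root_unity_powi_eq_1_iff) auto
  ultimately show ?thesis
    by (simp add: additive_char_def power_int_add root_unity_nonzero)
qed

lemma additive_char_nontrivial:
  assumes "a \<noteq> 0"
  shows "additive_char (a :: 'n::finite mod_ring) \<noteq> 1"
proof -
  have "0 \<le> to_int_mod_ring a" "to_int_mod_ring a < int CARD('n)"
    using range_to_int_mod_ring[where 'a = 'n] by (auto simp: set_eq_iff image_iff)
  moreover have "to_int_mod_ring a \<noteq> 0"
    using assms to_int_mod_ring_hom.eq_iff[of a 0] by simp
  ultimately have "\<not> int CARD('n) dvd to_int_mod_ring a"
    by (simp add: zdvd_not_zless order_less_le)
  then show ?thesis
    by (simp add: additive_char_def root_unity_powi_eq_1_iff)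
qed

text \<open>Shifting the summation index by the multiplicative identity leaves the sum unchanged and also
  multiplies it by \<open>\<chi>(a) \<noteq> 1\<close>.\<close>

lemma additive_char_orthogonality:
  fixes a :: "'n::finite mod_ring"
  assumes "a \<noteq> 0"
  shows "(\<Sum>l\<in>UNIV. additive_char (l * a)) = 0"
proof -
  let ?S = "\<Sum>l\<in>UNIV. additive_char (l * a)"
  \<comment> \<open>For a general \<open>'n\<close> the ring has no constant \<open>1\<close>; its identity is the image of the integer \<open>1\<close>,
    also for \<open>N = 1\<close>, where that image is \<open>0\<close>.\<close>
  define u :: "'n mod_ring" where "u = of_int_mod_ring 1"
  have u: "u * a = a"
    unfolding u_def by transfer (simp add: mod_simps)
  have "?S = (\<Sum>l\<in>UNIV. additive_char ((l + u) * a))"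
    by (rule sum.reindex_bij_betw[symmetric]) (rule bij_plus_right)
  also have "\<dots> = additive_char a * ?S"
    by (simp add: distrib_right additive_char_add u sum_distrib_left mult.commute[of "additive_char a"])
  finally show ?thesis
    using additive_char_nontrivial[OF assms] by simp
qed

text \<open>Fourier inversion when only the coefficient at frequency \<open>0\<close> is left: by orthogonality of
  characters the function equals its mean value.\<close>

lemma constant_if_fourier_vanishes:
  fixes f :: "'n::finite mod_ring \<Rightarrow> complex"
  assumes "\<And>l. l \<noteq> 0 \<Longrightarrow> (\<Sum>n\<in>UNIV. additive_char (l * n) * f n) = 0"
  shows "of_nat CARD('n) * f m = (\<Sum>n\<in>UNIV. f n)"
proof -
  let ?F = "\<lambda>l. \<Sum>n\<in>UNIV. additive_char (l * n) * f n"
  let ?K = "\<lambda>n. \<Sum>l\<in>UNIV. additive_char (l * (n - m))"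
  have twist: "additive_char (l * (n - m)) = additive_char (- (l * m)) * additive_char (l * n)"
    for l n
    unfolding additive_char_add[symmetric] by (simp add: right_diff_distrib)
  have "(\<Sum>l\<in>UNIV. additive_char (- (l * m)) * ?F l)
      = (\<Sum>l\<in>UNIV. \<Sum>n\<in>UNIV. additive_char (l * (n - m)) * f n)"
    by (simp add: twist sum_distrib_left mult.assoc)
  also have "\<dots> = (\<Sum>n\<in>UNIV. ?K n * f n)"
    by (subst sum.swap) (simp add: sum_distrib_right)
  also have "\<dots> = (\<Sum>n\<in>UNIV. if n = m then of_nat CARD('n) * f n else 0)"
    by (intro sum.cong) (auto simp: additive_char_orthogonality additive_char_0)
  also have "\<dots> = of_nat CARD('n) * f m"
    by simp
  finally have "of_nat CARD('n) * f m = (\<Sum>l\<in>UNIV. additive_char (- (l * m)) * ?F l)" ..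
  also have "\<dots> = (\<Sum>l\<in>(UNIV :: 'n mod_ring set). if l = 0 then ?F 0 else 0)"
    using assms by (intro sum.cong[OF refl]) (auto simp: additive_char_0)
  also have "\<dots> = (\<Sum>n\<in>UNIV. f n)"
    by (simp add: additive_char_0)
  finally show ?thesis .
qed

lemma gabor_nth: "gabor g (p, l) $ n = additive_char (l * n) * g $ (n - p)"
  by (simp add: gabor_def modulation_def translation_def additive_char_def)

lemma cscalar_product_gabor:
  "cscalar_product x (gabor g (p, l))
    = (\<Sum>n\<in>UNIV. additive_char (l * n) * (cnj (x $ n) * g $ (n - p)))"
  by (simp add: cscalar_product_def gabor_nth algebra_simps)

lemma cscalar_product_axis: "cscalar_product (axis i 1) y = y $ i"
proof -
  have "cscalar_product (axis i 1) y = (\<Sum>j\<in>UNIV. if j = i then y $ j else 0)"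
    unfolding cscalar_product_def by (intro sum.cong) (auto simp: axis_def)
  then show ?thesis by simp
qed

lemma cscalar_product_add_left:
  "cscalar_product (x + x') y = cscalar_product x y + cscalar_product x' y"
  by (simp add: cscalar_product_def distrib_right sum.distrib)

lemma cscalar_product_diff_left:
  "cscalar_product (x - x') y = cscalar_product x y - cscalar_product x' y"
  by (simp add: cscalar_product_def left_diff_distrib sum_subtractf)

text \<open>Entry \<open>i\<close> would force the phase between the sum and the difference to be \<open>1\<close>, and entry \<open>j\<close>
  would force it to be \<open>-1\<close>.\<close>

lemma no_phase_retrieval_if_disjoint_entries:
  assumes "i \<noteq> j" and "\<And>k. G k $ i = 0 \<or> G k $ j = 0"
  shows "\<not> allows_phase_retrieval G"
proof
  assume retrieval: "allows_phase_retrieval G"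
  let ?x = "axis i 1 + axis j (1 :: complex)" and ?y = "axis i 1 - axis j (1 :: complex)"
  have "cmod (cscalar_product ?x (G k)) = cmod (cscalar_product ?y (G k))" for k
    using assms(2)[of k]
    by (auto simp: cscalar_product_add_left cscalar_product_diff_left cscalar_product_axis)
  then obtain c where c: "?x = c *s ?y"
    using retrieval unfolding allows_phase_retrieval_def by blast
  have "?x $ i = c * ?y $ i" "?x $ j = c * ?y $ j"
    by (simp_all only: c vector_smult_component)
  then show False
    using assms(1) by (simp add: axis_def)
qed

lemma no_phase_retrieval_if_equal_moduli:
  assumes "i \<noteq> j" and "\<And>k. cmod (G k $ i) = cmod (G k $ j)"
  shows "\<not> allows_phase_retrieval G"
proof
  assume "allows_phase_retrieval G"
  then obtain c where c: "axis i 1 = c *s axis j (1::complex)"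
    using assms(2) unfolding allows_phase_retrieval_def by (metis cscalar_product_axis)
  have "axis i (1::complex) $ i = c * axis j 1 $ i"
    by (simp only: c vector_smult_component)
  then show False
    using assms(1) by (simp add: axis_def)
qed

theorem proposition2p3:
  fixes g :: "complex ^ ('n::finite mod_ring)"
  assumes "CARD('n) \<ge> 2"
    and "(\<exists>p. p \<noteq> 0 \<and> (\<forall>l. cscalar_product g (gabor g (p, l)) = 0)) \<or>
         (\<forall>l. l \<noteq> 0 \<longrightarrow> cscalar_product g (gabor g (0, l)) = 0)"
  shows "\<not> allows_phase_retrieval (gabor g)"
  using assms(2)
proof
  assume "\<exists>p. p \<noteq> 0 \<and> (\<forall>l. cscalar_product g (gabor g (p, l)) = 0)"
  then obtain p where "p \<noteq> 0"
    and orth: "cscalar_product g (gabor g (p, l)) = 0" for l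
    by blast
  let ?f = "\<lambda>n. cnj (g $ n) * g $ (n - p)"
  have fourier: "(\<Sum>n\<in>UNIV. additive_char (l * n) * ?f n) = 0" for l
    using orth[of l] by (simp add: cscalar_product_gabor)
  have "of_nat CARD('n) * ?f m = 0" for m
    using constant_if_fourier_vanishes[of ?f m] fourier fourier[of 0]
    by (simp add: additive_char_0)
  then have disjoint: "g $ m = 0 \<or> g $ (m - p) = 0" for m
    by simp
  have "gabor g k $ 0 = 0 \<or> gabor g k $ p = 0" for k
  proof (cases k)
    case (Pair q l)
    show ?thesis
      using disjoint[of "p - q"] by (auto simp: Pair gabor_nth)
  qed
  then show ?thesis
    using \<open>p \<noteq> 0\<close> by (intro no_phase_retrieval_if_disjoint_entries[of 0 p]) auto
next
  assume orth: "\<forall>l. l \<noteq> 0 \<longrightarrow> cscalar_product g (gabor g (0, l)) = 0"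
  let ?f = "\<lambda>n. cnj (g $ n) * g $ n"
  have mean: "of_nat CARD('n) * ?f m = (\<Sum>n\<in>UNIV. ?f n)" for m
    using orth by (intro constant_if_fourier_vanishes) (simp add: cscalar_product_gabor)
  have "of_nat CARD('n) * ?f m = of_nat CARD('n) * ?f n" for m n
    unfolding mean ..
  then have "?f m = ?f n" for m n
    by simp
  then have "cmod (?f m) = cmod (?f n)" for m n
    by (rule arg_cong)
  then have flat: "cmod (g $ m) = cmod (g $ n)" for m n
    by (simp add: norm_mult power2_eq_square[symmetric])
  have "\<not> card (UNIV :: 'n mod_ring set) \<le> Suc 0"
    using assms(1) by simp
  then obtain i j :: "'n mod_ring" where "i \<noteq> j"
    by (metis card_le_Suc0_iff_eq finite)
  moreover have "cmod (gabor g k $ i) = cmod (gabor g k $ j)" for k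
    using flat by (cases k) (simp add: gabor_nth norm_mult norm_additive_char)
  ultimately show ?thesis
    by (rule no_phase_retrieval_if_equal_moduli)
qed

end
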